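(* Let $H$ be a finite group with $|H|\geq 3$, let $\mathcal{G}=\{G_1,\ldots,G_t\}$ ($t\geq 1$) be a finite family of finite groups, and for each integer $k\geq 1$ let $(Q_k,\sigma_k)$ be a separating pair of level $k$ for $(H,\mathcal{G})$ (as defined in the context). Let $\mathcal{W}_{H,\mathcal{G}}$ be the class of all ai-semirings $S$ such that $S\models\sigma_k$ for every $k\geq 1$. Then: (i) $\mathsf{V}(\mathcal{P}(H)^0,\mathcal{P}(G_1)^0,\ldots,\mathcal{P}(G_t)^0)\subseteq\mathcal{W}_{H,\mathcal{G}}$; (ii) $\mathcal{W}_{H,\mathcal{G}}^0=\mathcal{W}_{H,\mathcal{G}}$; (iii) every ai-semiring variety $\mathcal{V}$ with $\mathsf{V}(\mathcal{P}(H))\subseteq\mathcal{V}\subseteq\mathcal{W}_{H,\mathcal{G}}$ has infinite axiomatic rank and is nonfinitely based.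
   Context: An additively idempotent semiring (ai-semiring) is an algebra $(S,+,\cdot)$ with two binary operations (no constants in the signature) such that $(S,+)$ is a commutative idempotent semigroup, $(S,\cdot)$ is a semigroup, and multiplication distributes over addition on both sides. Every ai-semiring term can be written as a finite nonempty sum of words (elements of the free semigroup over a countably infinite set of variables). The content of a word is the set of variables occurring in it. An ai-semiring inequality $\mathbf{u}\preceq\mathbf{v}$ between terms means the identity $\mathbf{v}\approx\mathbf{v}+\mathbf{u}$. For a semigroup $S$, $\mathcal{P}(S)$ is the ai-semiring of all nonempty subsets of $S$ with $A+B=A\cup B$ and $AB=\{ab:a\in A,\ b\in B\}$; $\mathcal{P}(S)^0$ is the ai-semiring of all subsets of $S$ (including $\varnothing$) with the same operations. For any ai-semiring $S$, $S^0=S\cup\{0\}$ is obtained by adjoining a new element $0$ with $a+0=0+a=a$ and $a0=0a=0$ for all $a\in S^0$. $\mathsf{V}(\ldots)$ or $\mathsf{V}\{\ldots\}$ denotes the variety generated by the listed ai-semirings. For an ai-semiring variety $\mathcal{U}$, $\mathcal{U}^0=\mathsf{V}\{S^0:S\in\mathcal{U}\}$. Separating pair of level $k$ for $(H,\mathcal{G})$: a pair $(Q_k,\sigma_k)$ consisting of a finite commutative (i.e. multiplicatively commutative) ai-semiring $Q_k$ and an inequality $\sigma_k$ such that (a) every subsemiring of $Q_k$ generated by at most $k$ elements belongs to $\mathsf{V}(\mathcal{P}(H))$; (b) $Q_k\not\models\sigma_k$; (c) $\mathcal{P}(H)^0,\mathcal{P}(G_1)^0,\ldots,\mathcal{P}(G_t)^0$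 all satisfy $\sigma_k$; (d) every word (summand) on either side of $\sigma_k$ has the same content. (Such pairs exist for every $k\geq1$.) A variety is finitely based if its identities admit a finite basis, and nonfinitely based otherwise. A variety has infinite axiomatic rank if, for every positive integer $k$, its identities involving at most $k$ variables do not form a basis for all its identities. *)

theory Defs
  imports "HOL-Algebra.Coset"
begin

section \<open>Additively idempotent semirings\<close>

text \<open>The signature consists of two binary operations only, so the ring record of HOL-Algebra,
  which has fields for zero and one, is not used.\<close>

record 'a ai_struct = "'a partial_object" +
  ai_plus :: "'a \<Rightarrow> 'a \<Rightarrow> 'a"
  ai_times :: "'a \<Rightarrow> 'a \<Rightarrow> 'a"

locale ai_semiring =
  fixes S :: "'a ai_struct"
  assumes nonempty: "carrier S \<noteq> {}"
    and plus_closed: "\<lbrakk>a \<in> carrier S; b \<in> carrier S\<rbrakk> \<Longrightarrow> ai_plus S a b \<in> carrier S"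
    and times_closed: "\<lbrakk>a \<in> carrier S; b \<in> carrier S\<rbrakk> \<Longrightarrow> ai_times S a b \<in> carrier S"
    and plus_assoc: "\<lbrakk>a \<in> carrier S; b \<in> carrier S; c \<in> carrier S\<rbrakk>
      \<Longrightarrow> ai_plus S (ai_plus S a b) c = ai_plus S a (ai_plus S b c)"
    and plus_comm: "\<lbrakk>a \<in> carrier S; b \<in> carrier S\<rbrakk> \<Longrightarrow> ai_plus S a b = ai_plus S b a"
    and plus_idem: "a \<in> carrier S \<Longrightarrow> ai_plus S a a = a"
    and times_assoc: "\<lbrakk>a \<in> carrier S; b \<in> carrier S; c \<in> carrier S\<rbrakk>
      \<Longrightarrow> ai_times S (ai_times S a b) c = ai_times S a (ai_times S b c)"
    and distrib_left: "\<lbrakk>a \<in> carrier S; b \<in> carrier S; c \<in> carrier S\<rbrakk>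
      \<Longrightarrow> ai_times S a (ai_plus S b c) = ai_plus S (ai_times S a b) (ai_times S a c)"
    and distrib_right: "\<lbrakk>a \<in> carrier S; b \<in> carrier S; c \<in> carrier S\<rbrakk>
      \<Longrightarrow> ai_times S (ai_plus S a b) c = ai_plus S (ai_times S a c) (ai_times S b c)"

definition mult_commutative :: "'a ai_struct \<Rightarrow> bool" where
  "mult_commutative S \<longleftrightarrow> (\<forall>a\<in>carrier S. \<forall>b\<in>carrier S. ai_times S a b = ai_times S b a)"

inductive_set generated_set :: "'a ai_struct \<Rightarrow> 'a set \<Rightarrow> 'a set"
  for S :: "'a ai_struct" and X :: "'a set" where
  base: "x \<in> X \<Longrightarrow> x \<in> generated_set S X"
| plus: "\<lbrakk>a \<in> generated_set S X; b \<in> generated_set S X\<rbrakk> \<Longrightarrow> ai_plus S a b \<in> generated_set S X"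
| times: "\<lbrakk>a \<in> generated_set S X; b \<in> generated_set S X\<rbrakk> \<Longrightarrow> ai_times S a b \<in> generated_set S X"

definition generated_subsemiring :: "'a ai_struct \<Rightarrow> 'a set \<Rightarrow> 'a ai_struct" where
  "generated_subsemiring S X = S\<lparr>carrier := generated_set S X\<rparr>"

text \<open>The ai-semirings of nonempty subsets, and of all subsets, of a semigroup. The unit field of
  the monoid record plays no role.\<close>

definition power_sr :: "('g, 'm) monoid_scheme \<Rightarrow> 'g set ai_struct" where
  "power_sr G = \<lparr>carrier = Pow (carrier G) - {{}}, ai_plus = (\<union>), ai_times = set_mult G\<rparr>"

definition power_sr0 :: "('g, 'm) monoid_scheme \<Rightarrow> 'g set ai_struct" where
  "power_sr0 G = \<lparr>carrier = Pow (carrier G), ai_plus = (\<union>), ai_times = set_mult G\<rparr>"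

text \<open>The new zero element is \<^term>\<open>None\<close>.\<close>

definition adjoin_zero :: "'a ai_struct \<Rightarrow> 'a option ai_struct" where
  "adjoin_zero S =
    \<lparr>carrier = insert None (Some ` carrier S),
     ai_plus = (\<lambda>x y. case x of None \<Rightarrow> y
               | Some a \<Rightarrow> (case y of None \<Rightarrow> x | Some b \<Rightarrow> Some (ai_plus S a b))),
     ai_times = (\<lambda>x y. case x of None \<Rightarrow> None
               | Some a \<Rightarrow> (case y of None \<Rightarrow> None | Some b \<Rightarrow> Some (ai_times S a b)))\<rparr>"

lemma ai_semiring_power_sr0:
  assumes "group G"
  shows "ai_semiring (power_sr0 G)"
proof -
  interpret group G by fact
  show ?thesis
  proof
    fix a b c assume "a \<in> carrier (power_sr0 G)" "b \<in> carrier (power_sr0 G)" "c \<in> carrier (power_sr0 G)"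
    then show "ai_times (power_sr0 G) (ai_times (power_sr0 G) a b) c =
        ai_times (power_sr0 G) a (ai_times (power_sr0 G) b c)"
      by (simp add: power_sr0_def set_mult_assoc)
  qed (auto simp: power_sr0_def set_mult_def)
qed

lemma ai_semiring_power_sr:
  assumes "group G"
  shows "ai_semiring (power_sr G)"
proof -
  interpret group G by fact
  show ?thesis
  proof
    fix a b c assume "a \<in> carrier (power_sr G)" "b \<in> carrier (power_sr G)" "c \<in> carrier (power_sr G)"
    then show "ai_times (power_sr G) (ai_times (power_sr G) a b) c =
        ai_times (power_sr G) a (ai_times (power_sr G) b c)"
      by (simp add: power_sr_def set_mult_assoc)
  next
    show "carrier (power_sr G) \<noteq> {}"
      unfolding power_sr_def using one_closed by auto
  next
    fix a b assume "a \<in> carrier (power_sr G)" "b \<in> carrier (power_sr G)"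
    then obtain x y where ab: "a \<subseteq> carrier G" "b \<subseteq> carrier G" "x \<in> a" "y \<in> b"
      by (auto simp: power_sr_def)
    then have "x \<otimes>\<^bsub>G\<^esub> y \<in> a <#>\<^bsub>G\<^esub> b"
      unfolding set_mult_def by blast
    with ab set_mult_closed show "ai_times (power_sr G) a b \<in> carrier (power_sr G)"
      by (auto simp: power_sr_def)
  qed (auto simp: power_sr_def set_mult_def)
qed

lemma ai_semiring_adjoin_zero:
  assumes "ai_semiring S"
  shows "ai_semiring (adjoin_zero S)"
proof -
  interpret ai_semiring S by fact
  have [simp]: "carrier (adjoin_zero S) = insert None (Some ` carrier S)"
    "ai_plus (adjoin_zero S) None y = y" "ai_plus (adjoin_zero S) x None = x"
    "ai_plus (adjoin_zero S) (Some a) (Some b) = Some (ai_plus S a b)"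
    "ai_times (adjoin_zero S) None y = None" "ai_times (adjoin_zero S) x None = None"
    "ai_times (adjoin_zero S) (Some a) (Some b) = Some (ai_times S a b)" for x y a b
    by (auto simp: adjoin_zero_def split: option.split)
  show ?thesis
    by standard (auto simp: plus_closed times_closed plus_assoc plus_idem times_assoc
      distrib_left distrib_right intro: plus_comm)
qed

lemma ai_semiring_generated_subsemiring:
  assumes "ai_semiring S" "X \<subseteq> carrier S" "X \<noteq> {}"
  shows "ai_semiring (generated_subsemiring S X)"
proof -
  interpret ai_semiring S by fact
  have sub: "a \<in> carrier S" if "a \<in> generated_set S X" for a
    using that assms(2) by induction (auto intro: plus_closed times_closed)
  have "generated_set S X \<noteq> {}"
    using assms(3) by (auto intro: generated_set.base)
  moreover have [simp]: "carrier (generated_subsemiring S X) = generated_set S X"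
    "ai_plus (generated_subsemiring S X) = ai_plus S"
    "ai_times (generated_subsemiring S X) = ai_times S"
    by (simp_all add: generated_subsemiring_def)
  ultimately show ?thesis
    by unfold_locales
      (auto simp: sub plus_assoc plus_idem times_assoc distrib_left distrib_right
        generated_set.plus generated_set.times intro: plus_comm)
qed


section \<open>Terms and identities\<close>

datatype ai_term = Var nat | Plus ai_term ai_term | Times ai_term ai_term

type_synonym identity = "ai_term \<times> ai_term"

primrec vars :: "ai_term \<Rightarrow> nat set" where
  "vars (Var x) = {x}"
| "vars (Plus s t) = vars s \<union> vars t"
| "vars (Times s t) = vars s \<union> vars t"

text \<open>The words occurring as summands when a term is multiplied out to a sum of words.
  The content of a word \<open>w\<close> is \<^term>\<open>set w\<close>.\<close>

primrec summands :: "ai_term \<Rightarrow> nat list set" where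
  "summands (Var x) = {[x]}"
| "summands (Plus s t) = summands s \<union> summands t"
| "summands (Times s t) = {v @ w |v w. v \<in> summands s \<and> w \<in> summands t}"

primrec eval :: "'a ai_struct \<Rightarrow> (nat \<Rightarrow> 'a) \<Rightarrow> ai_term \<Rightarrow> 'a" where
  "eval S \<phi> (Var x) = \<phi> x"
| "eval S \<phi> (Plus s t) = ai_plus S (eval S \<phi> s) (eval S \<phi> t)"
| "eval S \<phi> (Times s t) = ai_times S (eval S \<phi> s) (eval S \<phi> t)"

definition satisfies :: "'a ai_struct \<Rightarrow> identity \<Rightarrow> bool" where
  "satisfies S e \<longleftrightarrow>
    (\<forall>\<phi>. range \<phi> \<subseteq> carrier S \<longrightarrow> eval S \<phi> (fst e) = eval S \<phi> (snd e))"

definition ineq :: "ai_term \<times> ai_term \<Rightarrow> identity" where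
  "ineq \<sigma> = (case \<sigma> of (u, v) \<Rightarrow> (v, Plus v u))"
  \<comment> \<open>the pair \<open>(u, v)\<close> stands for the inequality \<open>u \<preceq> v\<close>\<close>


section \<open>Varieties\<close>

text \<open>
  A variety is a class of ai-semirings defined by a set of identities. HOL has no type of all
  ai-semirings, so classes are formed relative to a type \<open>'u\<close> in which the carriers live.
  If \<open>'u\<close> is infinite, nothing is lost: an identity that fails in some ai-semiring fails in a
  finitely generated, hence countable, subsemiring of it, and this has a copy inside \<open>'u\<close>.
  So for sets of identities \<open>\<Sigma>\<close> and \<open>\<Delta>\<close>, inclusion (and equality) of the defined classes over
  \<open>'u\<close> agrees with inclusion (and equality) of the classes of all models.
\<close>

definition models :: "identity set \<Rightarrow> 'u ai_struct set" where
  "models \<Sigma> = {S. ai_semiring S \<and> (\<forall>e\<in>\<Sigma>. satisfies S e)}"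

definition variety :: "'u ai_struct set \<Rightarrow> bool" where
  "variety \<V> \<longleftrightarrow> (\<exists>\<Sigma>. \<V> = models \<Sigma>)"

text \<open>The variety generated by \<open>K\<close>: the intersection of all varieties that contain \<open>K\<close>. The
  generators need not live in the type over which the generated variety is formed.\<close>

definition variety_gen :: "'a ai_struct set \<Rightarrow> 'u ai_struct set" where
  "variety_gen K = \<Inter> {models \<Sigma> |\<Sigma>. K \<subseteq> models \<Sigma>}"

definition variety_zero :: "'u ai_struct set \<Rightarrow> 'u ai_struct set" where
  "variety_zero \<U> = variety_gen (adjoin_zero ` \<U>)"

definition identities_of :: "'u ai_struct set \<Rightarrow> identity set" where
  "identities_of \<V> = {e. \<forall>S\<in>\<V>. satisfies S e}"

definition num_vars :: "identity \<Rightarrow> nat" where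
  "num_vars e = card (vars (fst e) \<union> vars (snd e))"

definition is_basis :: "identity set \<Rightarrow> 'u ai_struct set \<Rightarrow> bool" where
  "is_basis \<Sigma> \<V> \<longleftrightarrow>
    \<Sigma> \<subseteq> identities_of \<V> \<and>
    (\<forall>S :: 'u ai_struct. ai_semiring S \<longrightarrow> (\<forall>e\<in>\<Sigma>. satisfies S e) \<longrightarrow>
      (\<forall>e\<in>identities_of \<V>. satisfies S e))"

definition finitely_based :: "'u ai_struct set \<Rightarrow> bool" where
  "finitely_based \<V> \<longleftrightarrow> (\<exists>\<Sigma>. finite \<Sigma> \<and> is_basis \<Sigma> \<V>)"

definition infinite_axiomatic_rank :: "'u ai_struct set \<Rightarrow> bool" where
  "infinite_axiomatic_rank \<V> \<longleftrightarrow>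
    (\<forall>k\<ge>1. \<not> is_basis {e \<in> identities_of \<V>. num_vars e \<le> k} \<V>)"


section \<open>Separating pairs\<close>

definition separating_pair ::
  "nat \<Rightarrow> 'g monoid \<Rightarrow> nat \<Rightarrow> (nat \<Rightarrow> 'g monoid) \<Rightarrow> 'q ai_struct \<Rightarrow> ai_term \<times> ai_term \<Rightarrow> bool"
  where
  "separating_pair k H t G Q \<sigma> \<longleftrightarrow>
    ai_semiring Q \<and> finite (carrier Q) \<and> mult_commutative Q \<and>
    (\<forall>X. X \<subseteq> carrier Q \<and> X \<noteq> {} \<and> card X \<le> k \<longrightarrow>
      generated_subsemiring Q X \<in> variety_gen {power_sr H}) \<and>
    \<not> satisfies Q (ineq \<sigma>) \<and>
    satisfies (power_sr0 H) (ineq \<sigma>) \<and>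
    (\<forall>i\<in>{1..t}. satisfies (power_sr0 (G i)) (ineq \<sigma>)) \<and>
    (\<forall>v \<in> summands (fst \<sigma>) \<union> summands (snd \<sigma>).
      \<forall>w \<in> summands (fst \<sigma>) \<union> summands (snd \<sigma>). set v = set w)"

definition sep_class :: "(nat \<Rightarrow> ai_term \<times> ai_term) \<Rightarrow> 'u ai_struct set" where
  "sep_class \<sigma> = {S. ai_semiring S \<and> (\<forall>k\<ge>1. satisfies S (ineq (\<sigma> k)))}"

end

theory Submission
  imports Defs
begin

text \<open>
  Since all words of \<open>\<sigma>\<^sub>k\<close> have the same content, an assignment into \<open>S\<^sup>0\<close> either sends
  some variable of \<open>\<sigma>\<^sub>k\<close> to the new zero, and then both sides vanish, or it takes place
  inside \<open>S\<close>; this gives (ii). For (iii), an identity of \<open>\<V>\<close> in at most \<open>k\<close> variables holds in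
  \<open>\<P>(H)\<close>, hence in every \<open>k\<close>-generated subsemiring of \<open>Q\<^sub>k\<close>, hence in \<open>Q\<^sub>k\<close>. But \<open>Q\<^sub>k\<close>
  violates \<open>\<sigma>\<^sub>k\<close>, which is an identity of \<open>\<V>\<close>.
\<close>

section \<open>Variables, words and evaluation of terms\<close>

lemma finite_vars: "finite (vars s)"
  by (induction s) auto

lemma vars_nonempty: "vars s \<noteq> {}"
  by (induction s) auto

lemma summands_nonempty: "summands s \<noteq> {}"
  by (induction s) auto

text \<open>A product loses no variable when multiplied out, because neither factor has an empty set
  of summands. This links content of words to variables of terms.\<close>

lemma vars_eq_Union_summands: "vars s = (\<Union>w\<in>summands s. set w)"
proof (induction s)
  case (Times s1 s2)
  have "(\<Union>w\<in>summands (Times s1 s2). set w) =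
      (\<Union>v\<in>summands s1. \<Union>w\<in>summands s2. set v \<union> set w)"
    by force
  also have "\<dots> = (\<Union>v\<in>summands s1. set v) \<union> (\<Union>w\<in>summands s2. set w)"
    using summands_nonempty[of s1] summands_nonempty[of s2] by blast
  finally show ?case
    using Times by simp
qed auto

lemma eval_cong: "(\<And>x. x \<in> vars s \<Longrightarrow> \<phi> x = \<psi> x) \<Longrightarrow> eval S \<phi> s = eval S \<psi> s"
  by (induction s) auto

lemma (in ai_semiring) eval_closed: "range \<phi> \<subseteq> carrier S \<Longrightarrow> eval S \<phi> s \<in> carrier S"
  by (induction s) (auto intro: plus_closed times_closed)

section \<open>Embeddings and copies over another type\<close>

definition ai_embedding :: "'a ai_struct \<Rightarrow> 'b ai_struct \<Rightarrow> ('a \<Rightarrow> 'b) \<Rightarrow> bool" where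
  "ai_embedding S T h \<longleftrightarrow> h ` carrier S \<subseteq> carrier T \<and> inj_on h (carrier S) \<and>
    (\<forall>a\<in>carrier S. \<forall>b\<in>carrier S. h (ai_plus S a b) = ai_plus T (h a) (h b) \<and>
      h (ai_times S a b) = ai_times T (h a) (h b))"

lemma eval_embedding:
  assumes "ai_semiring S" "ai_embedding S T h" "range \<phi> \<subseteq> carrier S"
  shows "eval T (h \<circ> \<phi>) s = h (eval S \<phi> s)"
  using assms(2) ai_semiring.eval_closed[OF assms(1,3)]
  by (induction s) (auto simp: ai_embedding_def)

text \<open>Assignments are pushed forward along \<open>h\<close>; injectivity on the carrier pulls
  the resulting equality back.\<close>

lemma satisfies_embedding:
  assumes S: "ai_semiring S" and h: "ai_embedding S T h" and e: "satisfies T e"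
  shows "satisfies S e"
  unfolding satisfies_def
proof (intro allI impI)
  fix \<phi> :: "nat \<Rightarrow> 'a" assume \<phi>: "range \<phi> \<subseteq> carrier S"
  then have "range (h \<circ> \<phi>) \<subseteq> carrier T"
    using h by (auto simp: ai_embedding_def)
  then have "eval T (h \<circ> \<phi>) (fst e) = eval T (h \<circ> \<phi>) (snd e)"
    using e unfolding satisfies_def by blast
  then have "h (eval S \<phi> (fst e)) = h (eval S \<phi> (snd e))"
    by (simp only: eval_embedding[OF S h \<phi>])
  moreover have "inj_on h (carrier S)"
    using h by (simp add: ai_embedding_def)
  ultimately show "eval S \<phi> (fst e) = eval S \<phi> (snd e)"
    using ai_semiring.eval_closed[OF S \<phi>] by (meson inj_onD)
qed

text \<open>Varieties over \<open>'u\<close> cannot contain \<open>power_sr H\<close> or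
  \<open>Q k\<close> literally, as these live over other types. An infinite \<open>'u\<close> has
  room for a copy with the same identities.\<close>

lemma finite_ai_semiring_copy:
  fixes S :: "'a ai_struct"
  assumes S: "ai_semiring S" and fin: "finite (carrier S)" and inf: "infinite (UNIV :: 'u set)"
  obtains T :: "'u ai_struct" where "ai_semiring T" "\<And>e. satisfies T e \<longleftrightarrow> satisfies S e"
proof -
  interpret ai_semiring S by fact
  obtain U :: "'u set" where "finite U" "card U = card (carrier S)"
    using inf infinite_arbitrarily_large by blast
  then obtain f where f: "bij_betw f (carrier S) U"
    using finite_same_card_bij[OF fin] by metis
  define g where "g = inv_into (carrier S) f"
  define T where "T = \<lparr>carrier = U, ai_plus = \<lambda>x y. f (ai_plus S (g x) (g y)),
    ai_times = \<lambda>x y. f (ai_times S (g x) (g y))\<rparr>"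
  have g: "bij_betw g U (carrier S)"
    unfolding g_def by (rule bij_betw_inv_into[OF f])
  have gf [simp]: "g (f a) = a" if "a \<in> carrier S" for a
    unfolding g_def using bij_betw_inv_into_left[OF f that] .
  have fg [simp]: "f (g x) = x" if "x \<in> U" for x
    unfolding g_def using bij_betw_inv_into_right[OF f that] .
  have fU [simp]: "f a \<in> U" if "a \<in> carrier S" for a
    using f that bij_betwE by blast
  have gS [simp]: "g x \<in> carrier S" if "x \<in> U" for x
    using g that bij_betwE by blast
  note closed [simp] = plus_closed times_closed
  have T: "ai_semiring T"
  proof
    show "carrier T \<noteq> {}"
      using nonempty fU by (fastforce simp: T_def)
  next
    fix a b assume "a \<in> carrier T" "b \<in> carrier T"
    then show "ai_plus T a b = ai_plus T b a"
      using plus_comm[of "g a" "g b"] by (simp add: T_def)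
  qed (simp_all add: T_def plus_assoc times_assoc plus_idem distrib_left distrib_right)
  have "ai_embedding S T f" "ai_embedding T S g"
    using f g by (auto simp: ai_embedding_def T_def bij_betw_def)
  then have "satisfies T e \<longleftrightarrow> satisfies S e" for e
    using satisfies_embedding[OF S, of T f] satisfies_embedding[OF T, of S g] by blast
  with T show thesis
    by (rule that)
qed

text \<open>The set of all identities of \<open>S\<close> is the largest \<Sigma> with
  \<open>S\<close> among its models, so it cuts out the smallest model class.\<close>

lemma variety_gen_singleton_iff:
  assumes "ai_semiring S"
  shows "T \<in> variety_gen {S} \<longleftrightarrow> ai_semiring T \<and> (\<forall>e. satisfies S e \<longrightarrow> satisfies T e)"
proof
  assume T: "T \<in> variety_gen {S}"
  have "{S} \<subseteq> models {e. satisfies S e}"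
    using assms by (simp add: models_def)
  then have "T \<in> models {e. satisfies S e}"
    using T unfolding variety_gen_def by blast
  then show "ai_semiring T \<and> (\<forall>e. satisfies S e \<longrightarrow> satisfies T e)"
    by (simp add: models_def)
next
  assume "ai_semiring T \<and> (\<forall>e. satisfies S e \<longrightarrow> satisfies T e)"
  then show "T \<in> variety_gen {S}"
    by (auto simp: variety_gen_def models_def)
qed

lemma sep_class_eq_models: "sep_class \<sigma> = models ((\<lambda>k. ineq (\<sigma> k)) ` {1..})"
  by (auto simp: sep_class_def models_def)

lemma separating_pairD:
  assumes "separating_pair k H t G Q \<sigma>"
  shows "ai_semiring Q" "finite (carrier Q)" "\<not> satisfies Q (ineq \<sigma>)"
    "\<And>X. \<lbrakk>X \<subseteq> carrier Q; X \<noteq> {}; card X \<le> k\<rbrakk>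
      \<Longrightarrow> generated_subsemiring Q X \<in> variety_gen {power_sr H}"
    "satisfies (power_sr0 H) (ineq \<sigma>)"
    "\<And>i. i \<in> {1..t} \<Longrightarrow> satisfies (power_sr0 (G i)) (ineq \<sigma>)"
    "\<forall>v \<in> summands (fst \<sigma>) \<union> summands (snd \<sigma>).
      \<forall>w \<in> summands (fst \<sigma>) \<union> summands (snd \<sigma>). set v = set w"
  using assms unfolding separating_pair_def by blast+

section \<open>Evaluation after adjoining a zero\<close>

lemma adjoin_zero_simps [simp]:
  "carrier (adjoin_zero S) = insert None (Some ` carrier S)"
  "ai_plus (adjoin_zero S) None y = y" "ai_plus (adjoin_zero S) x None = x"
  "ai_plus (adjoin_zero S) (Some a) (Some b) = Some (ai_plus S a b)"
  "ai_times (adjoin_zero S) None y = None" "ai_times (adjoin_zero S) x None = None"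
  "ai_times (adjoin_zero S) (Some a) (Some b) = Some (ai_times S a b)"
  by (auto simp: adjoin_zero_def split: option.split)

lemma ai_embedding_Some: "ai_embedding S (adjoin_zero S) Some"
  by (auto simp: ai_embedding_def)

lemma eval_adjoin_zero_None:
  "(\<And>w. w \<in> summands s \<Longrightarrow> \<exists>x\<in>set w. \<phi> x = None) \<Longrightarrow> eval (adjoin_zero S) \<phi> s = None"
proof (induction s)
  case (Times s1 s2)
  show ?case
  proof (cases "\<exists>v\<in>summands s1. \<forall>x\<in>set v. \<phi> x \<noteq> None")
    \<comment> \<open>If \<open>v\<close> avoids the zero, every product \<open>v @ w\<close> must
      meet it inside \<open>w\<close>, so the second factor vanishes. If there is no such
      \<open>v\<close>, the first factor vanishes.\<close>
    case True
    then obtain v where v: "v \<in> summands s1" "\<forall>x\<in>set v. \<phi> x \<noteq> None"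
      by blast
    have "\<exists>x\<in>set w. \<phi> x = None" if "w \<in> summands s2" for w
    proof -
      have "v @ w \<in> summands (Times s1 s2)"
        using v(1) that by auto
      then obtain x where "x \<in> set (v @ w)" "\<phi> x = None"
        using Times.prems by blast
      then show ?thesis
        using v(2) by auto
    qed
    then have "eval (adjoin_zero S) \<phi> s2 = None"
      by (rule Times.IH(2))
    then show ?thesis by simp
  next
    case False
    then have "eval (adjoin_zero S) \<phi> s1 = None"
      by (intro Times.IH(1)) metis
    then show ?thesis by simp
  qed
qed auto

lemma satisfies_adjoin_zero_ineq:
  assumes S: "ai_semiring S" and sat: "satisfies S (ineq \<sigma>)"
    and content: "\<forall>v \<in> summands (fst \<sigma>) \<union> summands (snd \<sigma>).
      \<forall>w \<in> summands (fst \<sigma>) \<union> summands (snd \<sigma>). set v = set w"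
  shows "satisfies (adjoin_zero S) (ineq \<sigma>)"
proof -
  obtain u v where \<sigma>: "\<sigma> = (u, v)"
    by (cases \<sigma>)
  have content': "set w = vars u \<union> vars v" if "w \<in> summands u \<union> summands v" for w
  proof
    show "set w \<subseteq> vars u \<union> vars v"
      using that unfolding vars_eq_Union_summands by blast
    show "vars u \<union> vars v \<subseteq> set w"
    proof
      fix x assume "x \<in> vars u \<union> vars v"
      then obtain w' where "w' \<in> summands u \<union> summands v" "x \<in> set w'"
        unfolding vars_eq_Union_summands by blast
      moreover have "set w' = set w"
        using content that calculation(1) unfolding \<sigma> fst_conv snd_conv by blast
      ultimately show "x \<in> set w"
        by simp
    qed
  qed
  have "eval (adjoin_zero S) \<phi> v = eval (adjoin_zero S) \<phi> (Plus v u)"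
    if \<phi>: "range \<phi> \<subseteq> carrier (adjoin_zero S)" for \<phi>
  proof (cases "\<exists>x\<in>vars u \<union> vars v. \<phi> x = None")
    case True
    \<comment> \<open>By \<open>content'\<close> the variable sent to zero occurs in every summand
      of both sides.\<close>
    then have "eval (adjoin_zero S) \<phi> s = None" if "s = u \<or> s = v" for s
      using that by (intro eval_adjoin_zero_None) (auto simp: content')
    then show ?thesis by simp
  next
    case False
    obtain a where a: "a \<in> carrier S"
      using ai_semiring.nonempty[OF S] by blast
    \<comment> \<open>Variables outside the inequality may still be sent to zero; they get the
      default \<open>a\<close>, so that \<psi> is an assignment into \<open>S\<close>.\<close>
    define \<psi> where "\<psi> x = (case \<phi> x of None \<Rightarrow> a | Some b \<Rightarrow> b)" for x
    have "\<psi> x \<in> carrier S" for x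
    proof -
      have "\<phi> x \<in> insert None (Some ` carrier S)"
        using \<phi> by auto
      then show ?thesis
        using a by (auto simp: \<psi>_def)
    qed
    then have \<psi>: "range \<psi> \<subseteq> carrier S"
      by blast
    have eval_eq: "eval (adjoin_zero S) \<phi> s = Some (eval S \<psi> s)"
      if "vars s \<subseteq> vars u \<union> vars v" for s
    proof -
      have "eval (adjoin_zero S) \<phi> s = eval (adjoin_zero S) (Some \<circ> \<psi>) s"
        using False that by (intro eval_cong) (auto simp: \<psi>_def split: option.split)
      then show ?thesis
        by (simp add: eval_embedding[OF S ai_embedding_Some \<psi>])
    qed
    have "eval S \<psi> v = eval S \<psi> (Plus v u)"
      using sat \<psi> by (simp add: satisfies_def ineq_def \<sigma>)
    moreover have "vars v \<subseteq> vars u \<union> vars v" "vars (Plus v u) \<subseteq> vars u \<union> vars v"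
      by auto
    ultimately show ?thesis
      by (simp only: eval_eq)
  qed
  then show ?thesis
    by (simp add: satisfies_def ineq_def \<sigma>)
qed

section \<open>Identities in boundedly many variables\<close>

lemma eval_generated_subsemiring:
  "eval (generated_subsemiring S X) \<phi> s = eval S \<phi> s"
  by (induction s) (auto simp: generated_subsemiring_def)

text \<open>An assignment matters only through its values at the variables of \<open>e\<close>, and
  these form a generating set of size at most \<open>num_vars e\<close>.\<close>

lemma satisfies_if_generated_subsemirings:
  assumes gen: "\<And>X. \<lbrakk>X \<subseteq> carrier S; X \<noteq> {}; finite X; card X \<le> num_vars e\<rbrakk>
      \<Longrightarrow> satisfies (generated_subsemiring S X) e"
  shows "satisfies S e"
  unfolding satisfies_def
proof (intro allI impI)
  fix \<phi> :: "nat \<Rightarrow> 'a" assume \<phi>: "range \<phi> \<subseteq> carrier S"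
  let ?V = "vars (fst e) \<union> vars (snd e)"
  define X where "X = \<phi> ` ?V"
  have X: "X \<subseteq> carrier S" "X \<noteq> {}" "finite X" "card X \<le> num_vars e"
    using \<phi> by (auto simp: X_def num_vars_def vars_nonempty finite_vars card_image_le)
  then obtain a where a: "a \<in> X"
    by blast
  \<comment> \<open>Assignments are total, so the irrelevant variables are redirected to some
    generator \<open>a\<close>.\<close>
  define \<psi> where "\<psi> x = (if x \<in> ?V then \<phi> x else a)" for x
  have "range \<psi> \<subseteq> X"
    using a by (auto simp: \<psi>_def X_def)
  then have "range \<psi> \<subseteq> carrier (generated_subsemiring S X)"
    by (auto simp: generated_subsemiring_def intro: generated_set.base)
  then have "eval S \<psi> (fst e) = eval S \<psi> (snd e)"
    using gen[OF X] unfolding satisfies_def eval_generated_subsemiring by blast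
  moreover have "eval S \<psi> (fst e) = eval S \<phi> (fst e)" "eval S \<psi> (snd e) = eval S \<phi> (snd e)"
    by (rule eval_cong; simp add: \<psi>_def)+
  ultimately show "eval S \<phi> (fst e) = eval S \<phi> (snd e)"
    by simp
qed

lemma identities_of_power_sr:
  fixes \<V> :: "'u ai_struct set"
  assumes inf: "infinite (UNIV :: 'u set)" and H: "group H" "finite (carrier H)"
    and sub: "variety_gen {power_sr H} \<subseteq> \<V>" and e: "e \<in> identities_of \<V>"
  shows "satisfies (power_sr H) e"
proof -
  have PH: "ai_semiring (power_sr H)"
    by (rule ai_semiring_power_sr[OF H(1)])
  have "finite (carrier (power_sr H))"
    using H(2) by (simp add: power_sr_def)
  then obtain T :: "'u ai_struct"
    where T: "ai_semiring T" "\<And>e. satisfies T e \<longleftrightarrow> satisfies (power_sr H) e"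
    using finite_ai_semiring_copy[OF PH _ inf] by blast
  then have "T \<in> variety_gen {power_sr H}"
    by (simp add: variety_gen_singleton_iff[OF PH])
  then have "satisfies T e"
    using sub e unfolding identities_of_def by blast
  then show ?thesis
    by (simp only: T(2))
qed

lemma infinite_axiomatic_rank_not_finitely_based:
  assumes "infinite_axiomatic_rank \<V>"
  shows "\<not> finitely_based \<V>"
proof
  assume "finitely_based \<V>"
  then obtain \<Sigma> where \<Sigma>: "finite \<Sigma>" "is_basis \<Sigma> \<V>"
    unfolding finitely_based_def by blast
  \<comment> \<open>Inserting 1 makes the maximum exist for empty \<Sigma> and gives a positive
    bound.\<close>
  define k where "k = Max (insert 1 (num_vars ` \<Sigma>))"
  have "k \<ge> 1"
    using \<Sigma>(1) by (simp add: k_def)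
  have "\<Sigma> \<subseteq> {e \<in> identities_of \<V>. num_vars e \<le> k}"
    using \<Sigma> by (auto simp: k_def is_basis_def)
  with \<Sigma>(2) have "is_basis {e \<in> identities_of \<V>. num_vars e \<le> k} \<V>"
    unfolding is_basis_def by blast
  with \<open>k \<ge> 1\<close> assms show False
    unfolding infinite_axiomatic_rank_def by blast
qed

theorem theorem7p3:
  fixes H :: "'g monoid"
    and G :: "nat \<Rightarrow> 'g monoid"
    and t :: nat
    and Q :: "nat \<Rightarrow> 'q ai_struct"
    and \<sigma> :: "nat \<Rightarrow> ai_term \<times> ai_term"
    and W :: "'u ai_struct set"
  assumes universe: "infinite (UNIV :: 'u set)"
    and H: "group H" "finite (carrier H)" "order H \<ge> 3"
    and t: "t \<ge> 1"
    and G: "\<And>i. i \<in> {1..t} \<Longrightarrow> group (G i) \<and> finite (carrier (G i))"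
    and sep: "\<And>k. k \<ge> 1 \<Longrightarrow> separating_pair k H t G (Q k) (\<sigma> k)"
    and W: "W = sep_class \<sigma>"
  shows "variety_gen (insert (power_sr0 H) ((\<lambda>i. power_sr0 (G i)) ` {1..t})) \<subseteq> W
    \<and> variety_zero W = W
    \<and> (\<forall>\<V> :: 'u ai_struct set.
         variety \<V> \<and> variety_gen {power_sr H} \<subseteq> \<V> \<and> \<V> \<subseteq> W \<longrightarrow>
           infinite_axiomatic_rank \<V> \<and> \<not> finitely_based \<V>)"
proof (intro conjI allI impI)
  \<comment> \<open>These models are taken over the type of the generators; the same identities
    define \<open>W\<close> over \<open>'u\<close>.\<close>
  have "insert (power_sr0 H) ((\<lambda>i. power_sr0 (G i)) ` {1..t})
      \<subseteq> models ((\<lambda>k. ineq (\<sigma> k)) ` {1..})"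
    using H(1) G separating_pairD(5,6)[OF sep] by (auto simp: models_def ai_semiring_power_sr0)
  then show "variety_gen (insert (power_sr0 H) ((\<lambda>i. power_sr0 (G i)) ` {1..t})) \<subseteq> W"
    unfolding W sep_class_eq_models variety_gen_def by blast
next
  have "adjoin_zero ` W \<subseteq> models ((\<lambda>k. ineq (\<sigma> k)) ` {1..})"
  proof -
    have "satisfies (adjoin_zero S) (ineq (\<sigma> k))" if "S \<in> W" "k \<ge> 1" for S k
      using that
      by (intro satisfies_adjoin_zero_ineq separating_pairD(7)[OF sep]) (auto simp: W sep_class_def)
    then show ?thesis
      by (auto simp: models_def W sep_class_def ai_semiring_adjoin_zero)
  qed
  then have "variety_zero W \<subseteq> W"
    unfolding W sep_class_eq_models variety_zero_def variety_gen_def by blast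
  moreover have "W \<subseteq> variety_zero W"
  proof -
    \<comment> \<open>Each \<open>S\<close> embeds into \<open>adjoin_zero S\<close> by
      \<open>Some\<close>, so it inherits all identities of the latter.\<close>
    have "S \<in> models \<Sigma>" if "S \<in> W" "adjoin_zero ` W \<subseteq> models \<Sigma>" for S \<Sigma>
    proof -
      have "ai_semiring S"
        using that(1) by (simp add: W sep_class_def)
      moreover have "satisfies (adjoin_zero S) e" if "e \<in> \<Sigma>" for e
        using \<open>S \<in> W\<close> \<open>adjoin_zero ` W \<subseteq> models \<Sigma>\<close> that by (auto simp: models_def)
      ultimately show ?thesis
        unfolding models_def by (blast intro: satisfies_embedding[OF _ ai_embedding_Some])
    qed
    then show ?thesis
      unfolding variety_zero_def variety_gen_def by blast
  qed
  ultimately show "variety_zero W = W" ..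
next
  fix \<V> :: "'u ai_struct set"
  assume \<V>: "variety \<V> \<and> variety_gen {power_sr H} \<subseteq> \<V> \<and> \<V> \<subseteq> W"
  show rank: "infinite_axiomatic_rank \<V>"
    unfolding infinite_axiomatic_rank_def
  proof (intro allI impI notI)
    fix k :: nat
    assume k: "k \<ge> 1" and basis: "is_basis {e \<in> identities_of \<V>. num_vars e \<le> k} \<V>"
    note Qk = separating_pairD[OF sep[OF k]]
    \<comment> \<open>\<open>is_basis\<close> quantifies over ai-semirings in \<open>'u\<close>, so
      the counterexample \<open>Q k\<close> is replaced by a copy there.\<close>
    obtain T :: "'u ai_struct"
      where T: "ai_semiring T" "\<And>e. satisfies T e \<longleftrightarrow> satisfies (Q k) e"
      using finite_ai_semiring_copy[OF Qk(1,2) universe] by blast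
    have "satisfies (Q k) e" if e: "e \<in> identities_of \<V>" "num_vars e \<le> k" for e
    proof (rule satisfies_if_generated_subsemirings)
      fix X assume "X \<subseteq> carrier (Q k)" "X \<noteq> {}" "card X \<le> num_vars e"
      then have "generated_subsemiring (Q k) X \<in> variety_gen {power_sr H}"
        using Qk(4) e(2) by simp
      moreover have "satisfies (power_sr H) e"
        using identities_of_power_sr[OF universe H(1,2) _ e(1)] \<V> by blast
      ultimately show "satisfies (generated_subsemiring (Q k) X) e"
        unfolding variety_gen_singleton_iff[OF ai_semiring_power_sr[OF H(1)]] by blast
    qed
    \<comment> \<open>The upper bound \<open>W\<close> makes the inequality an identity of \<V>; the
      lower bound was used above to pass from \<V> to \<open>power_sr H\<close>.\<close>
    moreover have "ineq (\<sigma> k) \<in> identities_of \<V>"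
      using \<V> k by (auto simp: W sep_class_def identities_of_def)
    ultimately have "satisfies T (ineq (\<sigma> k))"
      using basis T unfolding is_basis_def by blast
    with T(2) Qk(3) show False
      by simp
  qed
  show "\<not> finitely_based \<V>"
    by (rule infinite_axiomatic_rank_not_finitely_based[OF rank])
qed

end
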